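(* Let $S$ be a finite set, let $F$ be the free group on $S$, and let $R$ be a finite set of words over $S \cup S^{-1}$ (the relators). Let $U = v_1\, r_1^{\epsilon_1}\, v_2\, r_2^{\epsilon_2} \cdots v_N\, r_N^{\epsilon_N}\, v_{N+1}$ be any reduced proof word (with $N \ge 1$, $r_i \in R$, $\epsilon_i \in \{1,-1\}$, and each $v_i$ a freely reduced word). Then $U$ can be generated from the empty word $\varepsilon$ by a finite sequence of relator append moves and conjugation moves; that is, some finite sequence of such moves starting from $\varepsilon$ produces a marked word which, after freely reducing each of its segments lying outside the marked relator occurrences, is equal to $U$.
   Context: A proof word is a formal (not freely reduced) product $\prod_{i=1}^{N} u_i^{-1} r_i^{\pm 1} u_i$ with $r_i \in R$ and $u_i \in F$, in which the occurrences of the relators $r_i^{\pm1}$ are kept marked (delimited) and are never cancelled against the surrounding letters. Writing such a product as $v_1\, r_1^{\pm1}\, v_2\, r_2^{\pm1} \cdots v_N\, r_N^{\pm1}\, v_{N+1}$, where $v_1$ is the word $u_1^{-1}$, $v_i$ is the word $u_{i-1}u_i^{-1}$ for $2 \le i \le N$, and $v_{N+1}$ is the word $u_N$, the proof word is called reduced if each of the words $v_1, \dots, v_{N+1}$ is freely reduced. Moves act on marked words of this kind (strings over $S \cup S^{-1}$ with some marked relator occurrences): a conjugation move replaces a marked word $W$ by $x^{-1} W x$ for some $x \in S \cup S^{-1}$ (the letters $x^{-1}, x$ lie outside the marked relators); a relator append move replaces $W$ by $W r^{\pm 1}$ for some $r \in R$, the appended copy of $r^{\pm1}$ being marked. Free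 reduction is only ever performed on the unmarked segments between (and before/after) the marked relator occurrences. *)

theory Defs
  imports Main
begin

text \<open>A letter \<open>(s, True)\<close> stands for \<open>s\<close> and \<open>(s, False)\<close> for its formal inverse.\<close>

type_synonym 'a letter = "'a \<times> bool"
type_synonym 'a word = "'a letter list"

definition letters :: "'a set \<Rightarrow> 'a letter set" where
  "letters S = S \<times> UNIV"

definition words_over :: "'a set \<Rightarrow> 'a word set" where
  "words_over S = lists (letters S)"

definition inv_letter :: "'a letter \<Rightarrow> 'a letter" where
  "inv_letter x = (fst x, \<not> snd x)"

definition inv_word :: "'a word \<Rightarrow> 'a word" where
  "inv_word w = rev (map inv_letter w)"

text \<open>The sign \<open>True\<close> stands for the exponent \<open>1\<close>, \<open>False\<close> for \<open>-1\<close>. Inverses are formal: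
  no cancellation takes place.\<close>

definition signed_word :: "'a word \<Rightarrow> bool \<Rightarrow> 'a word" where
  "signed_word w e = (if e then w else inv_word w)"

definition freely_reduced :: "'a word \<Rightarrow> bool" where
  "freely_reduced w \<longleftrightarrow> \<not> (\<exists>p x q. w = p @ [x, inv_letter x] @ q)"

text \<open>The elements of the free group on \<open>S\<close>, represented by their unique freely reduced words.\<close>

definition free_group_elements :: "'a set \<Rightarrow> 'a word set" where
  "free_group_elements S = {w \<in> words_over S. freely_reduced w}"

text \<open>A marked relator occurrence is a single token that carries the string \<open>r\<close> or its inverse;
  its letters are thereby shielded from cancellation.\<close>

datatype 'a token = Letter "'a letter" | Marked "'a word"

type_synonym 'a marked_word = "'a token list"

definition unmarked :: "'a word \<Rightarrow> 'a marked_word" where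
  "unmarked v = map Letter v"

text \<open>Two adjacent \<open>Letter\<close> tokens always belong to the same unmarked segment, so the following
  step is an elementary free cancellation inside one such segment.\<close>

inductive cancel_step :: "'a marked_word \<Rightarrow> 'a marked_word \<Rightarrow> bool" where
  "cancel_step (A @ [Letter x, Letter (inv_letter x)] @ B) (A @ B)"

definition segmentwise_free_reduction :: "'a marked_word \<Rightarrow> 'a marked_word \<Rightarrow> bool" where
  "segmentwise_free_reduction W U \<longleftrightarrow>
     cancel_step\<^sup>*\<^sup>* W U \<and> \<not> (\<exists>V. cancel_step U V)"

inductive move :: "'a set \<Rightarrow> 'a word set \<Rightarrow> 'a marked_word \<Rightarrow> 'a marked_word \<Rightarrow> bool"
  for S :: "'a set" and R :: "'a word set" where
  conjugation: "x \<in> letters S \<Longrightarrow> move S R W ([Letter (inv_letter x)] @ W @ [Letter x])"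
| relator_append: "r \<in> R \<Longrightarrow> move S R W (W @ [Marked (signed_word r e)])"

definition marked_product ::
  "nat \<Rightarrow> (nat \<Rightarrow> 'a word) \<Rightarrow> (nat \<Rightarrow> 'a word) \<Rightarrow> (nat \<Rightarrow> bool) \<Rightarrow> 'a marked_word" where
  "marked_product N v r e =
     concat (map (\<lambda>i. unmarked (v i) @ [Marked (signed_word (r i) (e i))]) [1..<Suc N])
     @ unmarked (v (Suc N))"

text \<open>The formal product of the \<open>N\<close> conjugates of \<open>r i\<close> (with sign \<open>e i\<close>) by \<open>u i\<close>.\<close>

definition proof_word ::
  "nat \<Rightarrow> (nat \<Rightarrow> 'a word) \<Rightarrow> (nat \<Rightarrow> 'a word) \<Rightarrow> (nat \<Rightarrow> bool) \<Rightarrow> 'a marked_word" where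
  "proof_word N u r e =
     concat (map (\<lambda>i. unmarked (inv_word (u i)) @ [Marked (signed_word (r i) (e i))]
                      @ unmarked (u i)) [1..<Suc N])"

text \<open>The unmarked segments of such a product, as formal concatenations.\<close>

definition segment :: "nat \<Rightarrow> (nat \<Rightarrow> 'a word) \<Rightarrow> nat \<Rightarrow> 'a word" where
  "segment N u i =
     (if i = 1 then inv_word (u 1)
      else if i = Suc N then u N
      else u (i - 1) @ inv_word (u i))"

lemma proof_word_eq_marked_product:
  assumes "1 \<le> N"
  shows "proof_word N u r e = marked_product N (segment N u) r e"
proof -
  define g where
    "g i = (if i = 1 then inv_word (u 1) else u (i - 1) @ inv_word (u i))" for i
  have "proof_word N u r e =
    concat (map (\<lambda>i. unmarked (g i) @ [Marked (signed_word (r i) (e i))]) [1..<Suc N])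
    @ unmarked (u N)"
    using assms
    by (induction N rule: dec_induct) (simp_all add: proof_word_def g_def unmarked_def)
  moreover have "map (\<lambda>i. unmarked (segment N u i) @ [Marked (signed_word (r i) (e i))]) [1..<Suc N]
    = map (\<lambda>i. unmarked (g i) @ [Marked (signed_word (r i) (e i))]) [1..<Suc N]"
    by (rule map_cong) (auto simp: segment_def g_def)
  moreover have "segment N u (Suc N) = u N"
    using assms by (simp add: segment_def)
  ultimately show ?thesis
    by (simp only: marked_product_def)
qed

definition reduced_proof_word :: "'a set \<Rightarrow> 'a word set \<Rightarrow> 'a marked_word \<Rightarrow> bool" where
  "reduced_proof_word S R U \<longleftrightarrow>
     (\<exists>N u r e. 1 \<le> N \<and>
        (\<forall>i\<in>{1..N}. r i \<in> R \<and> u i \<in> free_group_elements S) \<and>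
        U = proof_word N u r e \<and>
        (\<forall>i\<in>{1..Suc N}. freely_reduced (segment N u i)))"

end

theory Submission
  imports Defs
begin

text \<open>Given a marked word \<open>W\<close>, conjugate it by \<open>u\<^sup>-\<^sup>1\<close>, append the marked relator \<open>r\<close> and conjugate by
  \<open>u\<close>. The result \<open>u\<^sup>-\<^sup>1 u W u\<^sup>-\<^sup>1 r u\<close> cancels to \<open>W u\<^sup>-\<^sup>1 r u\<close>, so the factors of a proof word can be
  produced one after the other from left to right. When the segments of the proof word are freely
  reduced, no cancellation applies to it, since a cancelling pair never straddles a marked
  relator.\<close>

lemma inv_letter_inv_letter [simp]: "inv_letter (inv_letter x) = x"
  by (simp add: inv_letter_def)

lemma inv_word_Nil [simp]: "inv_word [] = []"
  by (simp add: inv_word_def)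

lemma inv_word_Cons [simp]: "inv_word (x # w) = inv_word w @ [inv_letter x]"
  by (simp add: inv_word_def)

lemma inv_word_append [simp]: "inv_word (v @ w) = inv_word w @ inv_word v"
  by (simp add: inv_word_def)

lemma inv_word_inv_word [simp]: "inv_word (inv_word w) = w"
  by (induction w) simp_all

lemma inv_word_in_words_over: "w \<in> words_over S \<Longrightarrow> inv_word w \<in> words_over S"
  by (auto simp: words_over_def letters_def inv_word_def inv_letter_def lists_eq_set)

lemma unmarked_Nil [simp]: "unmarked [] = []"
  by (simp add: unmarked_def)

lemma unmarked_Cons [simp]: "unmarked (x # w) = Letter x # unmarked w"
  by (simp add: unmarked_def)

lemma unmarked_append [simp]: "unmarked (v @ w) = unmarked v @ unmarked w"
  by (simp add: unmarked_def)

lemma cancel_step_context: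
  assumes "cancel_step W W'"
  shows "cancel_step (A @ W @ B) (A @ W' @ B)"
  using assms
proof cases
  case (1 C x D)
  then show ?thesis
    using cancel_step.intros[of "A @ C" x "D @ B"] by simp
qed

lemma cancel_steps_context:
  "cancel_step\<^sup>*\<^sup>* W W' \<Longrightarrow> cancel_step\<^sup>*\<^sup>* (A @ W @ B) (A @ W' @ B)"
  by (induction rule: rtranclp_induct) (auto intro: rtranclp.rtrancl_into_rtrancl cancel_step_context)

text \<open>The first letter of \<open>w\<close> meets its inverse at the junction, so cancellation
  proceeds from the middle outwards.\<close>

lemma cancel_steps_inv_word:
  "cancel_step\<^sup>*\<^sup>* (unmarked (inv_word w) @ unmarked w) []"
proof (induction w)
  case (Cons x w)
  have "cancel_step (unmarked (inv_word (x # w)) @ unmarked (x # w))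
    (unmarked (inv_word w) @ unmarked w)"
    \<comment> \<open>The rule cancels a letter followed by its inverse; here the letter is
      \<open>inv_letter x\<close>, whose inverse is \<open>x\<close>.\<close>
    using cancel_step.intros[of "unmarked (inv_word w)" "inv_letter x" "unmarked w"] by simp
  with Cons.IH show ?case
    by (rule converse_rtranclp_into_rtranclp[rotated])
qed simp

text \<open>Each conjugation adds an outer layer, so the last letter of \<open>w\<close> is applied
  last; hence the induction from the right end.\<close>

lemma moves_conjugation_word:
  "w \<in> words_over S \<Longrightarrow> (move S R)\<^sup>*\<^sup>* W (unmarked (inv_word w) @ W @ unmarked w)"
proof (induction w rule: rev_induct)
  case (snoc x w)
  then have "(move S R)\<^sup>*\<^sup>* W (unmarked (inv_word w) @ W @ unmarked w)" and "x \<in> letters S"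
    by (auto simp: words_over_def)
  then show ?case
    using move.conjugation[of x S R "unmarked (inv_word w) @ W @ unmarked w"]
    by (auto intro: rtranclp.rtrancl_into_rtrancl)
qed simp

lemma proof_word_0 [simp]: "proof_word 0 u r e = []"
  by (simp add: proof_word_def)

lemma proof_word_Suc:
  "proof_word (Suc N) u r e = proof_word N u r e @ unmarked (inv_word (u (Suc N)))
     @ [Marked (signed_word (r (Suc N)) (e (Suc N)))] @ unmarked (u (Suc N))"
  by (simp add: proof_word_def)

text \<open>Moves never cancel anything, so the prefix that spells the trivial element stays in the
  result and is left for a later free reduction.\<close>

lemma moves_append_conjugate:
  assumes "u \<in> words_over S" and "r \<in> R"
  shows "(move S R)\<^sup>*\<^sup>* W (unmarked (inv_word u) @ unmarked u @ W @ unmarked (inv_word u)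
     @ [Marked (signed_word r e)] @ unmarked u)"
proof -
  let ?V = "unmarked u @ W @ unmarked (inv_word u)"
  \<comment> \<open>The conjugating word is \<open>inv_word u\<close>: this puts
    \<open>inv_word u\<close> where the relator will follow it, at the price of a \<open>u\<close>
    in front.\<close>
  have "(move S R)\<^sup>*\<^sup>* W ?V"
    using moves_conjugation_word[OF inv_word_in_words_over[OF assms(1)], of R W] by simp
  also have "move S R ?V (?V @ [Marked (signed_word r e)])"
    by (rule move.relator_append[OF assms(2)])
  also have "(move S R)\<^sup>*\<^sup>* \<dots> (unmarked (inv_word u) @ (?V @ [Marked (signed_word r e)]) @ unmarked u)"
    by (rule moves_conjugation_word[OF assms(1)])
  finally show ?thesis by simp
qed

text \<open>All cancellation is postponed until after the last move: the induction carries an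
  uncancelled \<open>W\<close>, and its cancellations are replayed inside the longer word.\<close>

lemma proof_word_generated:
  assumes "\<forall>i\<in>{1..N}. r i \<in> R \<and> u i \<in> words_over S"
  shows "\<exists>W. (move S R)\<^sup>*\<^sup>* [] W \<and> cancel_step\<^sup>*\<^sup>* W (proof_word N u r e)"
  using assms
proof (induction N)
  case (Suc N)
  then obtain W where W: "(move S R)\<^sup>*\<^sup>* [] W" "cancel_step\<^sup>*\<^sup>* W (proof_word N u r e)"
    by auto
  let ?u = "u (Suc N)"
  let ?T = "unmarked (inv_word ?u) @ [Marked (signed_word (r (Suc N)) (e (Suc N)))] @ unmarked ?u"
  have "(move S R)\<^sup>*\<^sup>* W (unmarked (inv_word ?u) @ unmarked ?u @ W @ ?T)"
    using Suc.prems by (intro moves_append_conjugate) auto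
  with W(1) have "(move S R)\<^sup>*\<^sup>* [] (unmarked (inv_word ?u) @ unmarked ?u @ W @ ?T)"
    by (rule rtranclp_trans)
  moreover have "cancel_step\<^sup>*\<^sup>* (unmarked (inv_word ?u) @ unmarked ?u @ W @ ?T) (W @ ?T)"
    using cancel_steps_context[OF cancel_steps_inv_word, of "[]" ?u "W @ ?T"] by simp
  moreover have "cancel_step\<^sup>*\<^sup>* (W @ ?T) (proof_word (Suc N) u r e)"
    using cancel_steps_context[OF W(2), of "[]" ?T] by (simp add: proof_word_Suc)
  ultimately show ?case
    by (meson rtranclp_trans)
qed auto

text \<open>The marked token is a barrier: a pair of adjacent letters lies wholly before it or
  wholly after it.\<close>

lemma adjacent_letters_split:
  assumes "unmarked v @ Marked m # Q = A @ [Letter x, Letter y] @ B"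
  shows "(\<exists>p q. v = p @ [x, y] @ q) \<or> (\<exists>A'. Q = A' @ [Letter x, Letter y] @ B)"
  using assms
proof (induction v arbitrary: A)
  case Nil
  then show ?case by (cases A) auto
next
  case (Cons z v)
  show ?case
  proof (cases A)
    case Nil
    \<comment> \<open>The pair starts at \<open>z\<close>. If \<open>v\<close> were empty, the
      second token would be the marked one, so \<open>v\<close> supplies \<open>y\<close>.\<close>
    with Cons.prems show ?thesis
      by (cases v) auto
  next
    case (Cons a A')
    with Cons.prems Cons.IH[of A'] show ?thesis
      by (metis append_Cons list.inject unmarked_Cons)
  qed
qed

text \<open>Splitting at one marked token after another locates the pair. An arbitrary index list
  \<open>js\<close> allows segments to be removed from the left; \<open>w\<close> has no marker
  after it and is the base case.\<close>

lemma adjacent_letters_in_segment: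
  assumes "concat (map (\<lambda>i. unmarked (v i) @ [Marked (m i)]) js) @ unmarked w
      = A @ [Letter x, Letter y] @ B"
  shows "\<exists>z \<in> insert w (v ` set js). \<exists>p q. z = p @ [x, y] @ q"
  using assms
proof (induction js arbitrary: A)
  case Nil
  then have "map Letter w = A @ [Letter x, Letter y] @ B"
    by (simp add: unmarked_def)
  then obtain p q where "w = p @ q" "map Letter q = Letter x # Letter y # B"
    by (auto simp: map_eq_append_conv)
  then have "\<exists>q'. w = p @ [x, y] @ q'"
    by (auto simp: map_eq_Cons_conv)
  then show ?case by blast
next
  case (Cons j js)
  let ?Q = "concat (map (\<lambda>i. unmarked (v i) @ [Marked (m i)]) js) @ unmarked w"
  have "unmarked (v j) @ Marked (m j) # ?Q = A @ [Letter x, Letter y] @ B"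
    using Cons.prems by simp
  then consider p q where "v j = p @ [x, y] @ q" | A' where "?Q = A' @ [Letter x, Letter y] @ B"
    by (blast dest: adjacent_letters_split)
  then show ?case
  proof cases
    case 1
    then show ?thesis by (intro bexI[of _ "v j"]) auto
  next
    case (2 A')
    from Cons.IH[OF this] show ?thesis by auto
  qed
qed

lemma marked_product_irreducible:
  assumes "\<forall>i\<in>{1..Suc N}. freely_reduced (v i)"
  shows "\<not> cancel_step (marked_product N v r e) V"
proof
  assume "cancel_step (marked_product N v r e) V"
  then obtain A x B where
    "marked_product N v r e = A @ [Letter x, Letter (inv_letter x)] @ B"
    by cases
  from adjacent_letters_in_segment[OF this[unfolded marked_product_def]]
  obtain z p q where "z \<in> insert (v (Suc N)) (v ` set [1..<Suc N])"
    "z = p @ [x, inv_letter x] @ q"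
    by (elim bexE exE)
  moreover from this(1) have "freely_reduced z"
    using assms by auto
  ultimately show False
    unfolding freely_reduced_def by blast
qed

theorem theorem1:
  fixes S :: "'a set" and R :: "'a word set" and U :: "'a marked_word"
  assumes "finite S"
    and "finite R"
    and "R \<subseteq> words_over S"
    and "reduced_proof_word S R U"
  shows "\<exists>W. (move S R)\<^sup>*\<^sup>* [] W \<and> segmentwise_free_reduction W U"
proof -
  from assms(4) obtain N u r e where "1 \<le> N"
    and ru: "\<forall>i\<in>{1..N}. r i \<in> R \<and> u i \<in> free_group_elements S"
    and U: "U = proof_word N u r e"
    and red: "\<forall>i\<in>{1..Suc N}. freely_reduced (segment N u i)"
    unfolding reduced_proof_word_def by blast
  have "\<exists>W. (move S R)\<^sup>*\<^sup>* [] W \<and> cancel_step\<^sup>*\<^sup>* W U"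
    unfolding U using ru by (intro proof_word_generated) (auto simp: free_group_elements_def)
  moreover have "\<not> cancel_step U V" for V
    \<comment> \<open>Merging neighbouring conjugators exposes the segments that \<open>red\<close>
      speaks of.\<close>
    unfolding U proof_word_eq_marked_product[OF \<open>1 \<le> N\<close>]
    using red by (rule marked_product_irreducible)
  ultimately show ?thesis
    unfolding segmentwise_free_reduction_def by blast
qed

end
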